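(* Every Hamiltonian graph has a leveled embedding.
   Context: All graphs are connected, undirected, simple and finite. A graph is Hamiltonian if it contains a cycle that visits every vertex exactly once. A graph embedding is an embedding $G\to S^3$ of a graph $G$, up to ambient isotopy; the spatial graph $\mathcal{G}$ is its image up to ambient isotopy. Everything is tame (piecewise linear). A cycle is unknotted if it can be embedded as the equator of a sphere $S^2$. The fragments of a graph $G$ with respect to a cycle $C$ are the closures of the connected components of $G-C$ (topologically; so an edge not in $C$ with both endpoints on $C$ is a fragment). A connected spatial graph $\mathcal{G}$ is leveled (is a leveled embedding of its underlying graph) if it contains an unknotted cycle $C$ (the spine) such that each fragment $f$ of $\mathcal{G}$ with respect to $C$ can be embedded in a disk $D_f$ whose boundary is identified with $C$, with interior disjoint from $\mathcal{G}-f$, in such a way that for distinct fragments $f,g$ the interiors of $D_f$ and $D_g$ do not intersect. *)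

theory Defs
  imports "HOL-Analysis.Analysis" "Graph_Theory.Digraph_Component"
begin

text \<open>
  Simple undirected finite graphs are the symmetric digraphs of the locale \<^locale>\<open>graph\<close>: an
  undirected edge is a pair of mutually reverse arcs. The predicate \<^const>\<open>pre_digraph.cycle\<close> then
  also admits the closed walk \<open>a, b, a\<close>, hence the bound on the length.
  Its distinctness condition makes each vertex on the walk the tail of exactly one arc of the walk.
\<close>

definition ugraph_cycle :: "('a, 'b) pre_digraph \<Rightarrow> 'b list \<Rightarrow> bool" where
  "ugraph_cycle G p \<longleftrightarrow> pre_digraph.cycle G p \<and> 3 \<le> length p"

definition hamiltonian :: "('a, 'b) pre_digraph \<Rightarrow> bool" where
  "hamiltonian G \<longleftrightarrow> (\<exists>p. ugraph_cycle G p \<and> tail G ` set p = verts G)"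

text \<open>
  Continuity on \<open>S\<close> is not required separately: it follows from \<open>f\<close> being affine on each of
  finitely many compact pieces.
\<close>

definition pl_on :: "'a::euclidean_space set \<Rightarrow> ('a \<Rightarrow> 'b::euclidean_space) \<Rightarrow> bool" where
  "pl_on S f \<longleftrightarrow> (\<exists>\<T>. finite \<T> \<and> \<Union>\<T> = S \<and>
     (\<forall>T\<in>\<T>. polytope T \<and> (\<exists>L c. linear L \<and> (\<forall>x\<in>T. f x = L x + c))))"

lemma pl_on_imp_continuous_on:
  assumes "pl_on S f" shows "continuous_on S f"
proof -
  obtain \<T> where T: "finite \<T>" "\<Union>\<T> = S"
    and aff: "\<And>T. T \<in> \<T> \<Longrightarrow> polytope T \<and> (\<exists>L c. linear L \<and> (\<forall>x\<in>T. f x = L x + c))"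
    using assms unfolding pl_on_def by metis
  have "continuous_on (\<Union>T\<in>\<T>. T) f"
  proof (rule continuous_on_closed_Union)
    fix T assume "T \<in> \<T>"
    then obtain L c where "polytope T" and L: "linear L" "\<forall>x\<in>T. f x = L x + c"
      using aff by blast
    then show "closed T"
      using polytope_imp_closed by blast
    have "continuous_on T (\<lambda>x. L x + c)"
      using L by (intro continuous_intros linear_continuous_on) (simp add: linear_conv_bounded_linear)
    then show "continuous_on T f"
      using L(2) continuous_on_eq by force
  qed (use T in auto)
  then show ?thesis
    using T by simp
qed

definition pl_homeomorphism ::
    "'a::euclidean_space set \<Rightarrow> 'b::euclidean_space set \<Rightarrow> ('a \<Rightarrow> 'b) \<Rightarrow> bool" where
  "pl_homeomorphism S T h \<longleftrightarrow> pl_on S h \<and> (\<exists>g. homeomorphism S T h g)"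

text \<open>
  The unit ball and sphere of the maximum norm (a cube and its boundary) are the standard
  piecewise linear ball and sphere; round spheres contain no segments.
\<close>

definition pl_ball :: "'a::euclidean_space set" where
  "pl_ball = {x. infnorm x \<le> 1}"

definition pl_sphere :: "'a::euclidean_space set" where
  "pl_sphere = {x. infnorm x = 1}"

abbreviation S3 :: "(real ^ 4) set" where
  "S3 \<equiv> pl_sphere"

definition equator :: "(real ^ 3) set" where
  "equator = {x \<in> pl_sphere. x $ 3 = 0}"

definition unknotted :: "(real ^ 4) set \<Rightarrow> bool" where
  "unknotted C \<longleftrightarrow> (\<exists>S h. S \<subseteq> S3 \<and> pl_homeomorphism (pl_sphere :: (real ^ 3) set) S h
     \<and> h ` equator = C)"

definition disk_with_boundary :: "(real ^ 4) set \<Rightarrow> (real ^ 4) set \<Rightarrow> bool" where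
  "disk_with_boundary D C \<longleftrightarrow> D \<subseteq> S3 \<and>
     (\<exists>h. pl_homeomorphism (pl_ball :: (real ^ 2) set) D h \<and> h ` pl_sphere = C)"

text \<open>
  A map from the geometric realization of \<open>G\<close> is a map \<open>\<phi>\<close> on the vertices and a path
  \<open>\<gamma> e\<close> from \<open>\<phi> (tail G e)\<close> to \<open>\<phi> (head G e)\<close> for each arc \<open>e\<close>; the two arcs of an undirected edge
  carry mutually reverse paths. As the realization is compact, the map is an embedding iff it
  is continuous and injective.
\<close>

definition graph_embedding ::
    "('a, 'b) pre_digraph \<Rightarrow> ('a \<Rightarrow> real ^ 4) \<Rightarrow> ('b \<Rightarrow> real \<Rightarrow> real ^ 4) \<Rightarrow> bool" where
  "graph_embedding G \<phi> \<gamma> \<longleftrightarrow>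
     \<phi> ` verts G \<subseteq> S3 \<and> inj_on \<phi> (verts G) \<and>
     (\<forall>e\<in>arcs G. arc (\<gamma> e) \<and> pl_on {0..1} (\<gamma> e) \<and> path_image (\<gamma> e) \<subseteq> S3 \<and>
        pathstart (\<gamma> e) = \<phi> (tail G e) \<and> pathfinish (\<gamma> e) = \<phi> (head G e)) \<and>
     (\<forall>e\<in>arcs G. \<forall>e'\<in>arcs G. tail G e' = head G e \<and> head G e' = tail G e \<longrightarrow>
        (\<forall>t\<in>{0..1}. \<gamma> e' t = reversepath (\<gamma> e) t)) \<and>
     (\<forall>e\<in>arcs G. \<forall>v\<in>verts G. \<phi> v \<in> path_image (\<gamma> e) \<longrightarrow> v \<in> {tail G e, head G e}) \<and>
     (\<forall>e\<in>arcs G. \<forall>e'\<in>arcs G. {tail G e, head G e} \<noteq> {tail G e', head G e'} \<longrightarrow>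
        path_image (\<gamma> e) \<inter> path_image (\<gamma> e')
          \<subseteq> \<phi> ` ({tail G e, head G e} \<inter> {tail G e', head G e'}))"

definition spatial_graph ::
    "('a, 'b) pre_digraph \<Rightarrow> ('a \<Rightarrow> real ^ 4) \<Rightarrow> ('b \<Rightarrow> real \<Rightarrow> real ^ 4) \<Rightarrow> (real ^ 4) set" where
  "spatial_graph G \<phi> \<gamma> = \<phi> ` verts G \<union> (\<Union>e\<in>arcs G. path_image (\<gamma> e))"

definition cycle_image :: "('b \<Rightarrow> real \<Rightarrow> real ^ 4) \<Rightarrow> 'b list \<Rightarrow> (real ^ 4) set" where
  "cycle_image \<gamma> p = (\<Union>e\<in>set p. path_image (\<gamma> e))"

definition fragments :: "(real ^ 4) set \<Rightarrow> (real ^ 4) set \<Rightarrow> (real ^ 4) set set" where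
  "fragments \<G> C = closure ` components (\<G> - C)"

definition spine :: "(real ^ 4) set \<Rightarrow> (real ^ 4) set \<Rightarrow> bool" where
  "spine \<G> C \<longleftrightarrow> unknotted C \<and>
     (\<exists>D. (\<forall>f\<in>fragments \<G> C. disk_with_boundary (D f) C \<and> f \<subseteq> D f \<and> (D f - C) \<inter> (\<G> - f) = {}) \<and>
          (\<forall>f\<in>fragments \<G> C. \<forall>g\<in>fragments \<G> C. f \<noteq> g \<longrightarrow> (D f - C) \<inter> (D g - C) = {}))"

definition leveled_embedding ::
    "('a, 'b) pre_digraph \<Rightarrow> ('a \<Rightarrow> real ^ 4) \<Rightarrow> ('b \<Rightarrow> real \<Rightarrow> real ^ 4) \<Rightarrow> bool" where
  "leveled_embedding G \<phi> \<gamma> \<longleftrightarrow> graph_embedding G \<phi> \<gamma> \<and>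
     (\<exists>p. ugraph_cycle G p \<and> spine (spatial_graph G \<phi> \<gamma>) (cycle_image \<gamma> p))"

end

theory Submission
  imports Defs
begin

text \<open>
  A Hamiltonian cycle of the graph is laid out along the boundary of a square, and every
  remaining edge, a chord, gets a disk of its own that is bounded by the square. All these disks are
  pages of a book: over the solid square the page with slope \<open>h\<close> is the graph of
  \<open>h * (1 - m)\<close>, where \<open>m\<close> is the maximum norm, a pyramid whose apex lies at height \<open>h\<close>. Two
  different pages meet only in the square (\<open>pages_disjoint\<close>), and this does not limit the number of
  chords, because the slope is an arbitrary number between -1 and 1. A chord climbs from one
  endpoint straight to the apex of its page and from there straight down to the other endpoint, so it is
  piecewise linear and meets the square only in its endpoints.

  All of this fits into a single facet of the cube whose boundary is the sphere of dimension 3.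
  The square is unknotted because it is the equator of the boundary of this facet
  (\<open>unknotted_square\<close>), and each page is a piecewise linear disk with the square as its
  boundary (\<open>disk_page\<close>).

  The construction depends only on the number \<open>n\<close> of vertices. It is carried out for the
  complete graph on \<open>0, ..., n - 1\<close> with the cycle that visits the vertices in this order
  (\<open>strands_Int\<close>, \<open>Union_sides\<close>), and a Hamiltonian graph inherits the embedding
  by numbering its vertices along the cycle (\<open>graph_embedding_strands\<close>). As the cycle passes through every
  vertex, the graph without the cycle is the disjoint union of the open chords. These are finitely many
  connected sets, each closed in the union, so they are its components, and the fragments are their
  closures (\<open>fragments_chords\<close>). The page of a chord is then the disk of its
  fragment (\<open>spine_square\<close>).
\<close>

section \<open>Piecewise linear maps\<close>

lemma pl_ball_eq_cbox: "(pl_ball :: 'a::euclidean_space set) = cbox (- One) One"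
proof -
  have "infnorm x \<le> 1 \<longleftrightarrow> (\<forall>b\<in>Basis. \<bar>x \<bullet> b\<bar> \<le> 1)" for x :: 'a
    by (simp add: infnorm_Max)
  then show ?thesis
    by (auto simp: pl_ball_def mem_box abs_le_iff)
qed

lemma pl_sphere_eq_facets:
  "(pl_sphere :: 'a::euclidean_space set) = (\<Union>b\<in>Basis. \<Union>s\<in>{-1, 1}. pl_ball \<inter> {x. b \<bullet> x = s})"
proof -
  have "infnorm x = 1 \<longleftrightarrow> infnorm x \<le> 1 \<and> (\<exists>b\<in>Basis. \<bar>x \<bullet> b\<bar> = 1)" for x :: 'a
  proof -
    have "infnorm x \<in> (\<lambda>b. \<bar>x \<bullet> b\<bar>) ` Basis"
      unfolding infnorm_Max by (rule Max_in) auto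
    moreover have "\<bar>x \<bullet> b\<bar> \<le> infnorm x" if "b \<in> Basis" for b
      by (simp add: Basis_le_infnorm that)
    ultimately show ?thesis
      by force
  qed
  then show ?thesis
    by (auto simp: pl_sphere_def pl_ball_def inner_commute abs_eq_iff')
qed

text \<open>
  The sphere is the union of its facets, and these are polytopes; an affine map needs no finer
  subdivision.
\<close>

lemma pl_on_sphere_affine:
  assumes "linear L"
  shows "pl_on pl_sphere (\<lambda>x. L x + c)"
proof -
  let ?T = "(\<lambda>(b, s). pl_ball \<inter> {x. b \<bullet> x = s}) ` ((Basis :: 'a set) \<times> {-1, 1::real})"
  have "\<Union>?T = pl_sphere"
    unfolding pl_sphere_eq_facets by auto
  moreover have "\<forall>T\<in>?T. polytope T"
    by (auto simp: pl_ball_eq_cbox polytope_interval polytope_Int_polyhedron polyhedron_hyperplane)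
  ultimately show ?thesis
    unfolding pl_on_def using assms by (intro exI[of _ ?T]) auto
qed

lemma compact_if_pl_on: "pl_on S f \<Longrightarrow> compact S"
  unfolding pl_on_def by (metis compact_Union polytope_imp_compact)

lemma pl_homeomorphism_if_inj_on:
  assumes "pl_on S f" "inj_on f S" "f ` S = T"
  shows "pl_homeomorphism S T f"
  unfolding pl_homeomorphism_def
  using assms homeomorphism_compact compact_if_pl_on pl_on_imp_continuous_on by metis

lemma pl_on_two_segments: "pl_on {0..1} (linepath a m +++ linepath m (b::'a::euclidean_space))"
proof -
  let ?g = "linepath a m +++ linepath m b"
  have linear: "linear (\<lambda>t::real. t *\<^sub>R v)" for v :: 'a
    by (simp add: linear_iff algebra_simps)
  have "?g t = t *\<^sub>R (2 *\<^sub>R (m - a)) + a" if "t \<in> {0..1/2}" for t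
    using that by (simp add: joinpaths_def linepath_def algebra_simps)
  then have 1: "\<exists>L c. linear L \<and> (\<forall>t\<in>{0..1/2}. ?g t = L t + c)"
    using linear by blast
  have "?g t = t *\<^sub>R (2 *\<^sub>R (b - m)) + (2 *\<^sub>R m - b)" if "t \<in> {1/2..1}" for t
    using that by (cases "t = 1/2") (simp_all add: joinpaths_def linepath_def algebra_simps flip: scaleR_2)
  then have 2: "\<exists>L c. linear L \<and> (\<forall>t\<in>{1/2..1}. ?g t = L t + c)"
    using linear by blast
  have "polytope {0..1/2::real}" "polytope {1/2..1::real}"
    using polytope_interval[of "0::real" "1/2"] polytope_interval[of "1/2::real" 1] by auto
  moreover have "\<Union>{{0..1/2}, {1/2..1}} = {0..1::real}"
    by auto
  ultimately show ?thesis
    unfolding pl_on_def using 1 2 by (intro exI[of _ "{{0..1/2}, {1/2..1}}"]) simp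
qed

lemma path_image_two_segments:
  "path_image (linepath a m +++ linepath m b) = closed_segment a m \<union> closed_segment m b"
  by (simp add: path_image_join)

lemma arc_two_segments:
  assumes "a \<noteq> m" "m \<noteq> b" "closed_segment a m \<inter> closed_segment m b \<subseteq> {m}"
  shows "arc (linepath a m +++ linepath m b)"
  using assms by (intro arc_join arc_linepath) auto

section \<open>Components of a finite disjoint union\<close>

text \<open>
  As the family is finite, each member is also open in the union: its complement is a finite union
  of closed sets. Hence a component cannot meet two members.
\<close>

lemma components_Union_disjoint:
  assumes fin: "finite \<X>" and disj: "pairwise disjnt \<X>"
    and X: "\<And>X. X \<in> \<X> \<Longrightarrow> Topological_Spaces.connected X \<and> X \<noteq> {} \<and> closedin (top_of_set (\<Union>\<X>)) X"
  shows "components (\<Union>\<X>) = \<X>"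
proof -
  have comp: "K = X" if K: "K \<in> components (\<Union>\<X>)" and "X \<in> \<X>" "K \<inter> X \<noteq> {}" for K X
  proof (rule ccontr)
    have KU: "K \<subseteq> \<Union>\<X>" and "Topological_Spaces.connected K"
      using K in_components_subset in_components_connected by auto
    have "X \<subseteq> K"
      using X[OF \<open>X \<in> \<X>\<close>] \<open>X \<in> \<X>\<close> \<open>K \<inter> X \<noteq> {}\<close> by (intro components_maximal[OF K]) auto
    moreover assume "K \<noteq> X"
    ultimately obtain k where "k \<in> K" "k \<notin> X"
      by auto
    then have meets: "K \<inter> \<Union>(\<X> - {X}) \<noteq> {}"
      using KU by auto
    \<comment> \<open>A member together with the union of the other members would be a separation of \<open>K\<close>.\<close>
    have "closedin (top_of_set K) (K \<inter> Y)"
      if Y: "closedin (top_of_set (\<Union>\<X>)) Y" for Y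
    proof -
      obtain T where "closed T" "Y = \<Union>\<X> \<inter> T"
        using Y unfolding closedin_closed by blast
      moreover from this KU have "K \<inter> Y = K \<inter> T"
        by blast
      ultimately show ?thesis
        unfolding closedin_closed by blast
    qed
    moreover have "closedin (top_of_set (\<Union>\<X>)) (\<Union>(\<X> - {X}))"
      using X fin by (intro closedin_Union) auto
    ultimately have "closedin (top_of_set K) (K \<inter> X)" "closedin (top_of_set K) (K \<inter> \<Union>(\<X> - {X}))"
      using X \<open>X \<in> \<X>\<close> by auto
    moreover have "K \<subseteq> (K \<inter> X) \<union> (K \<inter> \<Union>(\<X> - {X}))"
      using KU by blast
    moreover have "(K \<inter> X) \<inter> (K \<inter> \<Union>(\<X> - {X})) = {}"
      using disj \<open>X \<in> \<X>\<close> by (fastforce simp: pairwise_def disjnt_def)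
    ultimately show False
      using \<open>Topological_Spaces.connected K\<close> \<open>K \<inter> X \<noteq> {}\<close> meets unfolding connected_closedin by blast
  qed
  show ?thesis
  proof (intro equalityI subsetI)
    fix K assume K: "K \<in> components (\<Union>\<X>)"
    then obtain x where "x \<in> K" using in_components_nonempty by blast
    moreover then obtain X where "X \<in> \<X>" "x \<in> X" using K in_components_subset by blast
    ultimately show "K \<in> \<X>" using comp[OF K] by blast
  next
    fix X assume "X \<in> \<X>"
    then obtain x where "x \<in> X" using X by blast
    then have "x \<in> \<Union>\<X>" using \<open>X \<in> \<X>\<close> by blast
    then obtain K where "K \<in> components (\<Union>\<X>)" "x \<in> K"
      using Union_components by (metis UnionE)
    then show "X \<in> components (\<Union>\<X>)" using comp \<open>X \<in> \<X>\<close> \<open>x \<in> X\<close> by blast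
  qed
qed

section \<open>A book of disks in a facet of the cube\<close>

text \<open>
  The facet of the cube on which the last coordinate is 1 is a copy of the cube of dimension 3.
  The whole construction takes place in this facet, where segments are available.
\<close>

definition facet_point :: "real \<Rightarrow> real \<Rightarrow> real \<Rightarrow> real ^ 4" where
  "facet_point x y z = vector [x, y, z, 1]"

lemma facet_point_nth [simp]:
  "facet_point x y z $ 1 = x" "facet_point x y z $ 2 = y"
  "facet_point x y z $ 3 = z" "facet_point x y z $ 4 = 1"
  by (simp_all add: facet_point_def vector_def)

lemma facet_point_eq_iff [simp]:
  "facet_point x y z = facet_point x' y' z' \<longleftrightarrow> x = x' \<and> y = y' \<and> z = z'"
  by (auto simp: vec_eq_iff forall_4)

lemma facet_point_combination:
  "(1 - u) *\<^sub>R facet_point x y z + u *\<^sub>R facet_point x' y' z' =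
     facet_point ((1 - u) * x + u * x') ((1 - u) * y + u * y') ((1 - u) * z + u * z')"
  by (simp add: vec_eq_iff forall_4 algebra_simps)

lemma infnorm_3: "infnorm (x :: real ^ 3) = max \<bar>x $ 1\<bar> (max \<bar>x $ 2\<bar> \<bar>x $ 3\<bar>)"
  unfolding infnorm_cart UNIV_3 by (rule cSup_eq) auto

lemma infnorm_4: "infnorm (x :: real ^ 4) = max (max \<bar>x $ 1\<bar> \<bar>x $ 2\<bar>) (max \<bar>x $ 3\<bar> \<bar>x $ 4\<bar>)"
  unfolding infnorm_cart UNIV_4 by (rule cSup_eq) (auto simp: le_max_iff_disj)

lemma facet_point_in_S3:
  "facet_point x y z \<in> S3 \<longleftrightarrow> \<bar>x\<bar> \<le> 1 \<and> \<bar>y\<bar> \<le> 1 \<and> \<bar>z\<bar> \<le> 1"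
  by (auto simp: pl_sphere_def infnorm_4)

definition square :: "(real ^ 4) set" where
  "square = {facet_point x y 0 | x y. max \<bar>x\<bar> \<bar>y\<bar> = 1}"

definition apex :: "real \<Rightarrow> real ^ 4" where
  "apex h = facet_point 0 0 h"

text \<open>
  The lateral surface of the pyramid with top \<open>apex h\<close> whose base is bounded by \<open>square\<close>. All the
  pages have this boundary in common, like the pages of a book; they are told apart by the slope \<open>h\<close>.
\<close>

definition page :: "real \<Rightarrow> (real ^ 4) set" where
  "page h = {facet_point x y (h * (1 - max \<bar>x\<bar> \<bar>y\<bar>)) | x y. max \<bar>x\<bar> \<bar>y\<bar> \<le> 1}"

text \<open>
  The boundary of the facet is a copy of the sphere of the cube of dimension 3, under
  \<open>(x, y, z) \<mapsto> (x, y, z, 1)\<close>, and the square is its equator.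
\<close>

lemma unknotted_square: "unknotted square"
proof -
  let ?L = "\<lambda>x :: real ^ 3. (vector [x $ 1, x $ 2, x $ 3, 0] :: real ^ 4)"
  let ?h = "\<lambda>x :: real ^ 3. facet_point (x $ 1) (x $ 2) (x $ 3)"
  have "linear ?L"
    by (auto simp: linear_iff vec_eq_iff forall_4 vector_def)
  moreover have "?h = (\<lambda>x. ?L x + vector [0, 0, 0, 1])"
    by (auto simp: fun_eq_iff vec_eq_iff forall_4 vector_def)
  ultimately have "pl_on (pl_sphere :: (real ^ 3) set) ?h"
    by (simp only: pl_on_sphere_affine)
  moreover have "inj_on ?h pl_sphere"
    by (rule inj_onI, simp only: facet_point_eq_iff) (simp add: vec_eq_iff forall_3)
  ultimately have "pl_homeomorphism (pl_sphere :: (real ^ 3) set) (?h ` pl_sphere) ?h"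
    by (simp add: pl_homeomorphism_if_inj_on)
  moreover have "?h ` pl_sphere \<subseteq> S3"
    using facet_point_in_S3 by (force simp: pl_sphere_def[where 'a = "real ^ 3"] infnorm_3)
  moreover have "?h ` equator = square"
  proof
    show "?h ` equator \<subseteq> square"
      by (auto simp: equator_def square_def pl_sphere_def infnorm_3)
    show "square \<subseteq> ?h ` equator"
    proof
      fix q assume "q \<in> square"
      then obtain x y where "q = facet_point x y 0" "max \<bar>x\<bar> \<bar>y\<bar> = 1"
        by (auto simp: square_def)
      then show "q \<in> ?h ` equator"
        by (intro image_eqI[of _ _ "vector [x, y, 0]"]) (auto simp: equator_def pl_sphere_def infnorm_3)
    qed
  qed
  ultimately show ?thesis
    unfolding unknotted_def by blast
qed

lemma page_subset_S3: "\<bar>h\<bar> \<le> 1 \<Longrightarrow> page h \<subseteq> S3"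
proof -
  assume h: "\<bar>h\<bar> \<le> 1"
  have "\<bar>h * (1 - m)\<bar> \<le> 1" if "0 \<le> m" "m \<le> 1" for m
    using that h mult_mono[of "\<bar>h\<bar>" 1 "\<bar>1 - m\<bar>" 1] by (simp add: abs_mult)
  from this[of "max \<bar>_\<bar> \<bar>_\<bar>"] show "page h \<subseteq> S3"
    by (auto simp: page_def facet_point_in_S3)
qed

text \<open>
  The homeomorphism from the solid square lifts each point to the page. It is affine on
  each of the four triangles that the two diagonals cut out of the solid square, because on each of them
  the maximum norm is one of the linear forms \<open>\<plusminus>x\<close>, \<open>\<plusminus>y\<close>.
\<close>

lemma disk_page:
  assumes "\<bar>h\<bar> \<le> 1"
  shows "disk_with_boundary (page h) square"
proof -
  define f where "f = (\<lambda>x :: real ^ 2. facet_point (x $ 1) (x $ 2) (h * (1 - infnorm x)))"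
  \<comment> \<open>The triangle on which the maximum norm is the linear form \<open>(\<bullet>) c\<close>.\<close>
  define T where "T = (\<lambda>c :: real ^ 2. pl_ball \<inter> {x. infnorm x = c \<bullet> x})"
  let ?C = "{axis 1 1, axis 1 (-1), axis 2 1, axis 2 (-1)} :: (real ^ 2) set"
  have T_eq: "T c = pl_ball \<inter> ({x. axis 1 1 \<bullet> x \<le> c \<bullet> x} \<inter> {x. axis 1 (-1) \<bullet> x \<le> c \<bullet> x}
       \<inter> {x. axis 2 1 \<bullet> x \<le> c \<bullet> x} \<inter> {x. axis 2 (-1) \<bullet> x \<le> c \<bullet> x})" if "c \<in> ?C" for c
    using that by (auto simp: T_def infnorm_2 inner_axis')
  have half: "polyhedron {x. a \<bullet> x \<le> c \<bullet> x}" for a c :: "real ^ 2"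
    using polyhedron_halfspace_le[of "a - c" 0] by (simp add: inner_diff_left)
  have "polytope (T c)" if "c \<in> ?C" for c
    unfolding T_eq[OF that] pl_ball_eq_cbox
    by (intro polytope_Int_polyhedron polyhedron_Int polytope_interval half)
  moreover have "\<exists>L d. linear L \<and> (\<forall>x\<in>T c. f x = L x + d)" for c
  proof (intro exI conjI ballI)
    show "linear (\<lambda>x. vector [x $ 1, x $ 2, - h * (c \<bullet> x), 0] :: real ^ 4)"
      by (auto simp: linear_iff vec_eq_iff forall_4 vector_def inner_add_right algebra_simps)
    show "f x = vector [x $ 1, x $ 2, - h * (c \<bullet> x), 0] + vector [0, 0, h, 1]" if "x \<in> T c" for x
      using that by (auto simp: T_def f_def vec_eq_iff forall_4 vector_def algebra_simps)
  qed
  moreover have "\<Union>(T ` ?C) = pl_ball"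
    by (auto simp: T_def infnorm_2 inner_axis' max_def abs_if)
  ultimately have "pl_on pl_ball f"
    unfolding pl_on_def by (intro exI[of _ "T ` ?C"]) blast
  moreover have "inj_on f pl_ball"
    unfolding f_def by (rule inj_onI, simp only: facet_point_eq_iff) (simp add: vec_eq_iff forall_2)
  \<comment> \<open>One computation serves both the disk and its boundary.\<close>
  moreover have "f ` {x. P (infnorm x)} = {facet_point x y (h * (1 - max \<bar>x\<bar> \<bar>y\<bar>)) | x y. P (max \<bar>x\<bar> \<bar>y\<bar>)}"
    for P
  proof -
    have "facet_point x y (h * (1 - max \<bar>x\<bar> \<bar>y\<bar>)) = f (vector [x, y])" for x y
      by (simp add: f_def infnorm_2)
    moreover have "infnorm (vector [x, y] :: real ^ 2) = max \<bar>x\<bar> \<bar>y\<bar>" for x y :: real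
      by (simp add: infnorm_2)
    ultimately have "{facet_point x y (h * (1 - max \<bar>x\<bar> \<bar>y\<bar>)) | x y. P (max \<bar>x\<bar> \<bar>y\<bar>)}
        \<subseteq> f ` {x. P (infnorm x)}"
      by fastforce
    moreover have "f ` {x. P (infnorm x)}
        \<subseteq> {facet_point x y (h * (1 - max \<bar>x\<bar> \<bar>y\<bar>)) | x y. P (max \<bar>x\<bar> \<bar>y\<bar>)}"
      by (auto simp: f_def infnorm_2)
    ultimately show ?thesis
      by blast
  qed
  from this[of "\<lambda>r. r \<le> 1"] this[of "\<lambda>r. r = 1"]
  have "f ` pl_ball = page h" "f ` pl_sphere = square"
    by (auto simp: pl_ball_def pl_sphere_def page_def square_def)
  ultimately show ?thesis
    unfolding disk_with_boundary_def
    using page_subset_S3[OF assms] pl_homeomorphism_if_inj_on by blast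
qed

lemma square_subset_page: "square \<subseteq> page h"
  by (auto simp: square_def page_def)

text \<open>
  Over a point of maximum norm \<open>m\<close> the pages have heights \<open>h * (1 - m)\<close> and
  \<open>h' * (1 - m)\<close>; these agree only if \<open>m = 1\<close>.
\<close>

lemma pages_disjoint:
  assumes "h \<noteq> h'"
  shows "(page h - square) \<inter> page h' = {}"
proof -
  have "p \<in> square" if ph: "p \<in> page h" and ph': "p \<in> page h'" for p
  proof -
    obtain x y where p: "p = facet_point x y (h * (1 - max \<bar>x\<bar> \<bar>y\<bar>))"
      using ph by (auto simp: page_def)
    with ph' have "h * (1 - max \<bar>x\<bar> \<bar>y\<bar>) = h' * (1 - max \<bar>x\<bar> \<bar>y\<bar>)"
      by (auto simp: page_def)
    then have "max \<bar>x\<bar> \<bar>y\<bar> = 1"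
      using assms by simp
    then show ?thesis
      by (auto simp: square_def p)
  qed
  then show ?thesis by blast
qed

lemma spoke_points:
  "closed_segment (facet_point x y 0) (apex h) = {facet_point (t * x) (t * y) (h * (1 - t)) | t. 0 \<le> t \<and> t \<le> 1}"
proof -
  have "closed_segment (facet_point x y 0) (apex h) = (\<lambda>t. facet_point (t * x) (t * y) (h * (1 - t))) ` {0..1}"
    by (subst closed_segment_commute)
      (simp add: apex_def closed_segment_image_interval facet_point_combination mult.commute)
  then show ?thesis by auto
qed

lemma max_abs_scale: "0 \<le> t \<Longrightarrow> max \<bar>x\<bar> \<bar>y\<bar> = 1 \<Longrightarrow> max \<bar>t * x\<bar> \<bar>t * y\<bar> = (t::real)"
  using max_mult_distrib_left[of t "\<bar>x\<bar>" "\<bar>y\<bar>"] by (simp add: abs_mult)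

text \<open>
  The segments from the square to an apex lie in the page, because the page is a cone with this
  apex. A chord will consist of two of them.
\<close>

lemma spoke_subset_page:
  assumes "q \<in> square"
  shows "closed_segment q (apex h) \<subseteq> page h"
proof -
  from assms obtain x y where q: "q = facet_point x y 0" and m: "max \<bar>x\<bar> \<bar>y\<bar> = 1"
    by (auto simp: square_def)
  have "facet_point (t * x) (t * y) (h * (1 - t)) \<in> page h" if "0 \<le> t" "t \<le> 1" for t
    unfolding page_def using max_abs_scale[OF that(1) m] that by (auto intro!: exI[of _ "t * x"] exI[of _ "t * y"])
  then show ?thesis
    unfolding q spoke_points by blast
qed

lemma spoke_Int_square:
  assumes "q \<in> square"
  shows "closed_segment q (apex h) \<inter> square = {q}"
proof -
  from assms obtain x y where q: "q = facet_point x y 0" and m: "max \<bar>x\<bar> \<bar>y\<bar> = 1"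
    by (auto simp: square_def)
  have "t = 1" if "0 \<le> t" "facet_point (t * x) (t * y) (h * (1 - t)) \<in> square" for t
    using that max_abs_scale[OF that(1) m] by (auto simp: square_def)
  then have "closed_segment q (apex h) \<inter> square \<subseteq> {q}"
    unfolding q spoke_points by auto
  then show ?thesis using assms by auto
qed

text \<open>
  The maximum norm of a point on a spoke determines its position on it, so two spokes that meet
  away from the apex start at the same point of the square.
\<close>

lemma spokes_Int:
  assumes "q \<in> square" "r \<in> square" "q \<noteq> r"
  shows "closed_segment q (apex h) \<inter> closed_segment (apex h) r \<subseteq> {apex h}"
proof -
  obtain x y where q: "q = facet_point x y 0" and m: "max \<bar>x\<bar> \<bar>y\<bar> = 1"
    using assms by (auto simp: square_def)
  obtain x' y' where r: "r = facet_point x' y' 0" and m': "max \<bar>x'\<bar> \<bar>y'\<bar> = 1"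
    using assms by (auto simp: square_def)
  show ?thesis
  proof
    fix p assume "p \<in> closed_segment q (apex h) \<inter> closed_segment (apex h) r"
    then obtain t s where t: "0 \<le> t" "0 \<le> s" "t * x = s * x'" "t * y = s * y'"
      and p: "p = facet_point (t * x) (t * y) (h * (1 - t))"
      unfolding closed_segment_commute[of "apex h" r] unfolding q r spoke_points by auto
    have "t = 0"
    proof (rule ccontr)
      assume "t \<noteq> 0"
      moreover have "t = s"
        using max_abs_scale[OF t(1) m] max_abs_scale[OF t(2) m'] t by simp
      ultimately show False using t assms(3) q r by auto
    qed
    then show "p \<in> {apex h}"
      by (simp add: p apex_def)
  qed
qed

lemma apex_notin_square: "apex h \<notin> square"
  by (auto simp: apex_def square_def)

section \<open>A Hamiltonian cycle along the square\<close>

text \<open>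
  Node 0 is the lower left corner; the other nodes run along the upper edge of the square from the
  upper right corner towards, but not reaching, the upper left corner. The choice \<open>2 / i - 1\<close> has this
  property for every number of nodes, so the positions do not depend on it.
\<close>

definition node :: "nat \<Rightarrow> real ^ 4" where
  "node i = (if i = 0 then facet_point (-1) (-1) 0 else facet_point (2 / real i - 1) 1 0)"

text \<open>
  The two corners of the square that are not nodes become the bends of the sides
  next to node 0; every other side is straight, and its midpoint serves as its bend. So all sides, and
  later all chords, are made of two segments.
\<close>

definition bend :: "nat \<Rightarrow> nat \<Rightarrow> real ^ 4" where
  "bend n i = (if i = 0 then facet_point 1 (-1) 0 else if Suc i = n then facet_point (-1) 1 0
     else midpoint (node i) (node (Suc i)))"

definition side :: "nat \<Rightarrow> nat \<Rightarrow> (real ^ 4) set" where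
  "side n i = closed_segment (node i) (bend n i) \<union> closed_segment (bend n i) (node (Suc i mod n))"

lemma node_in_square: "node i \<in> square"
proof (cases "i = 0")
  case False
  then have "\<bar>2 / real i - 1\<bar> \<le> 1" by (simp add: abs_le_iff field_simps)
  then show ?thesis using False by (auto simp: node_def square_def)
qed (auto simp: node_def square_def)

lemma node_eq_iff [simp]: "node i = node j \<longleftrightarrow> i = j"
  by (auto simp: node_def field_simps)

lemma closed_segment_horizontal:
  assumes "a \<le> b"
  shows "closed_segment (facet_point a y 0) (facet_point b y 0) = (\<lambda>x. facet_point x y 0) ` {a..b}"
proof -
  have "closed_segment (facet_point a y 0) (facet_point b y 0) = (\<lambda>x. facet_point x y 0) ` closed_segment a b"
    unfolding closed_segment_image_interval facet_point_combination image_image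
    by (simp flip: distrib_right)
  then show ?thesis using assms by (simp add: closed_segment_eq_real_ivl)
qed

lemma closed_segment_vertical:
  assumes "a \<le> b"
  shows "closed_segment (facet_point x a 0) (facet_point x b 0) = (\<lambda>y. facet_point x y 0) ` {a..b}"
proof -
  have "closed_segment (facet_point x a 0) (facet_point x b 0) = (\<lambda>y. facet_point x y 0) ` closed_segment a b"
    unfolding closed_segment_image_interval facet_point_combination image_image
    by (simp flip: distrib_right)
  then show ?thesis using assms by (simp add: closed_segment_eq_real_ivl)
qed

lemma side_first:
  assumes "2 \<le> n"
  shows "side n 0 = (\<lambda>x. facet_point x (-1) 0) ` {-1..1} \<union> (\<lambda>y. facet_point 1 y 0) ` {-1..1}"
  using assms by (simp add: side_def node_def bend_def closed_segment_horizontal closed_segment_vertical)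

lemma side_middle:
  assumes "0 < i" "Suc i < n"
  shows "side n i = (\<lambda>x. facet_point x 1 0) ` {2 / real (Suc i) - 1..2 / real i - 1}"
proof -
  have "side n i = closed_segment (node i) (node (Suc i))"
    using assms by (simp add: side_def bend_def Un_closed_segment)
  also have "\<dots> = closed_segment (facet_point (2 / real (Suc i) - 1) 1 0) (facet_point (2 / real i - 1) 1 0)"
    using assms by (simp add: node_def closed_segment_commute)
  also have "\<dots> = (\<lambda>x. facet_point x 1 0) ` {2 / real (Suc i) - 1..2 / real i - 1}"
    using assms by (intro closed_segment_horizontal) (simp add: field_simps)
  finally show ?thesis .
qed

lemma side_last:
  assumes "0 < i" "n = Suc i"
  shows "side n i = (\<lambda>x. facet_point x 1 0) ` {-1..2 / real i - 1} \<union> (\<lambda>y. facet_point (-1) y 0) ` {-1..1}"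
  using assms
  by (simp add: side_def node_def bend_def closed_segment_horizontal closed_segment_vertical
      closed_segment_commute[of "facet_point (2 / real i - 1) 1 0"]
      closed_segment_commute[of "facet_point (-1) 1 0" "facet_point (-1) (-1) 0"])

lemma side_subset_square:
  assumes "3 \<le> n" "i < n"
  shows "side n i \<subseteq> square"
proof -
  have le1: "\<bar>x\<bar> \<le> 1" if "a \<le> x" "x \<le> 2 / real k - 1" "- 1 \<le> a" "0 < k" for x a :: real and k :: nat
  proof -
    have "2 / real k \<le> 2" using that by (simp add: field_simps)
    then show ?thesis using that by linarith
  qed
  consider "i = 0" | "0 < i" "Suc i < n" | "0 < i" "n = Suc i"
    using assms by linarith
  then show ?thesis
  proof cases
    case 1
    then show ?thesis using assms by (auto simp: side_first square_def)
  next
    case 2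
    then have "\<bar>x\<bar> \<le> 1" if "x \<in> {2 / real (Suc i) - 1..2 / real i - 1}" for x
      using that by (intro le1[of "2 / real (Suc i) - 1" x i]) auto
    then show ?thesis using 2 unfolding side_middle[OF 2] square_def by fastforce
  next
    case 3
    then have "\<bar>x\<bar> \<le> 1" if "x \<in> {-1..2 / real i - 1}" for x
      using that by (intro le1[of "-1" x i]) auto
    then show ?thesis using 3 unfolding side_last[OF 3] square_def by fastforce
  qed
qed

text \<open>
  The bends are chosen so that the sides turn at all four corners. A point on the upper
  edge at \<open>x\<close> lies between the nodes \<open>i\<close> and \<open>i + 1\<close> for \<open>i = \<lfloor>2 / (x + 1)\<rfloor>\<close>, unless it
  is at or to the left of the last node.
\<close>

lemma Union_sides:
  assumes "3 \<le> n"
  shows "(\<Union>i<n. side n i) = square"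
proof
  show "(\<Union>i<n. side n i) \<subseteq> square"
    using side_subset_square[OF assms] by blast
  show "square \<subseteq> (\<Union>i<n. side n i)"
  proof
    fix q assume "q \<in> square"
    then obtain x y where q: "q = facet_point x y 0" and m: "max \<bar>x\<bar> \<bar>y\<bar> = 1"
      by (auto simp: square_def)
    have "max \<bar>x\<bar> \<bar>y\<bar> \<le> 1" using m by simp
    then have bounds: "x \<in> {-1..1}" "y \<in> {-1..1}" by (simp_all add: abs_le_iff)
    consider "y = -1 \<or> x = 1" | "x = -1 \<or> y = 1 \<and> x \<le> 2 / real (n - 1) - 1"
      | "y = 1" "x > 2 / real (n - 1) - 1"
      using m by (fastforce simp: max_def abs_if split: if_splits)
    then show "q \<in> (\<Union>i<n. side n i)"
    proof cases
      case 1
      then have "q \<in> side n 0"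
        using assms bounds unfolding q by (auto simp: side_first)
      then show ?thesis using assms by auto
    next
      case 2
      then have "q \<in> side n (n - 1)"
        using bounds assms unfolding q by (subst side_last) auto
      then show ?thesis using assms by (intro UN_I[of "n - 1"]) auto
    next
      case 3
      define i where "i = nat \<lfloor>2 / (x + 1)\<rfloor>"
      have n1: "0 < real (n - 1)" using assms by simp
      then have "0 < 2 / real (n - 1)" by simp
      also have "\<dots> < x + 1" using 3(2) by (simp only: diff_less_eq)
      finally have x: "0 < x + 1" "x \<le> 1" using bounds(1) by auto
      then have "1 \<le> 2 / (x + 1)" by (simp add: field_simps)
      then have i: "0 < i" "real i \<le> 2 / (x + 1)" "2 / (x + 1) < real (Suc i)"
        unfolding i_def by linarith+
      note i(2)
      also have "2 / (x + 1) < real (n - 1)"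
        using \<open>2 / real (n - 1) < x + 1\<close> x n1 by (simp only: divide_less_eq less_divide_eq) (simp add: mult.commute)
      finally have "Suc i < n" by linarith
      moreover have "q \<in> side n i"
        unfolding side_middle[OF i(1) \<open>Suc i < n\<close>] using i x 3 q
        by (intro image_eqI[of _ _ x]) (auto simp: field_simps)
      ultimately show ?thesis by (intro UN_I[of i]) auto
    qed
  qed
qed

text \<open>
  Only the first and the last side leave the upper edge of the square, and they meet only in node 0. On
  the upper edge the sides are consecutive intervals, so they meet only in a shared endpoint.
\<close>

lemma sides_Int_ordered:
  assumes n: "3 \<le> n" and "i < j" "j < n"
  shows "side n i \<inter> side n j \<subseteq> node ` ({i, Suc i mod n} \<inter> {j, Suc j mod n})"
proof
  fix q assume "q \<in> side n i \<inter> side n j"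
  then have qi: "q \<in> side n i" and qj: "q \<in> side n j" by auto
  consider "i = 0" "n = Suc j" | "i = 0" "Suc j < n" | "0 < i" "Suc j < n" | "0 < i" "n = Suc j"
    using assms by linarith
  then show "q \<in> node ` ({i, Suc i mod n} \<inter> {j, Suc j mod n})"
  proof cases
    case 1
    moreover from this have "2 / real j < 2"
      using n by (simp add: field_simps)
    ultimately have "q = node 0"
      using qi qj n by (auto simp: side_first side_last node_def)
    then show ?thesis using 1 by auto
  next
    case 2
    then have j: "0 < j" using assms by simp
    obtain x where x: "q = facet_point x 1 0" "x \<le> 2 / real j - 1"
      using qj unfolding side_middle[OF j \<open>Suc j < n\<close>] by auto
    then have "x = 1" using qi 2 n by (auto simp: side_first)
    then have "j = 1" using x j by (simp add: field_simps)
    then have "q = node 1" using x \<open>x = 1\<close> by (simp add: node_def)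
    then show ?thesis using 2 \<open>j = 1\<close> n by auto
  next
    case 3
    then have "Suc i < n" "0 < j" using assms by auto
    obtain x where x: "q = facet_point x 1 0" "x \<le> 2 / real j - 1"
      using qj unfolding side_middle[OF \<open>0 < j\<close> \<open>Suc j < n\<close>] by auto
    have "2 / real (Suc i) - 1 \<le> x"
      using qi x unfolding side_middle[OF \<open>0 < i\<close> \<open>Suc i < n\<close>] by auto
    then have "2 / real (Suc i) \<le> 2 / real j" using x by linarith
    then have "j = Suc i" using assms by (simp add: field_simps)
    then have "q = node j" using x \<open>2 / real (Suc i) - 1 \<le> x\<close> by (simp add: node_def)
    then show ?thesis using \<open>j = Suc i\<close> assms by auto
  next
    case 4
    then have "Suc i < n" "0 < j" using assms by auto
    obtain x where x: "q = facet_point x 1 0" "2 / real (Suc i) - 1 \<le> x"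
      using qi unfolding side_middle[OF \<open>0 < i\<close> \<open>Suc i < n\<close>] by auto
    moreover have "0 < 2 / real (Suc i)" by simp
    ultimately have "- 1 < x" by linarith
    then have "x \<le> 2 / real j - 1"
      using qj x unfolding side_last[OF \<open>0 < j\<close> \<open>n = Suc j\<close>] by auto
    then have "2 / real (Suc i) \<le> 2 / real j" using x by linarith
    then have "j = Suc i" using assms by (simp add: field_simps)
    then have "q = node j" using x \<open>x \<le> 2 / real j - 1\<close> by (simp add: node_def)
    then show ?thesis using \<open>j = Suc i\<close> assms by auto
  qed
qed

lemma sides_Int:
  assumes "3 \<le> n" "i < n" "j < n" "i \<noteq> j"
  shows "side n i \<inter> side n j \<subseteq> node ` ({i, Suc i mod n} \<inter> {j, Suc j mod n})"
  using assms sides_Int_ordered[of n i j] sides_Int_ordered[of n j i]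
  by (metis Int_commute linorder_neqE_nat)

lemma arc_side:
  assumes "3 \<le> n" "i < n"
  shows "arc (linepath (node i) (bend n i) +++ linepath (bend n i) (node (Suc i mod n)))"
proof -
  consider "i = 0" | "0 < i" "Suc i < n" | "0 < i" "n = Suc i"
    using assms by linarith
  then show ?thesis
  proof cases
    case 1
    with assms show ?thesis
      by (intro arc_two_segments)
        (auto simp: node_def bend_def closed_segment_horizontal closed_segment_vertical)
  next
    case 2
    then have "bend n i = midpoint (node i) (node (Suc i))" "Suc i mod n = Suc i"
      by (auto simp: bend_def)
    moreover have "node i \<noteq> node (Suc i)" by simp
    moreover from this have "node i \<noteq> midpoint (node i) (node (Suc i))"
      by (metis midpoint_eq_endpoint(1))
    ultimately show ?thesis
      by (intro arc_two_segments) (simp_all add: Int_closed_segment)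
  next
    case 3
    moreover have "2 / real i \<noteq> 0" using 3 by simp
    ultimately show ?thesis
      by (intro arc_two_segments)
        (auto simp: node_def bend_def closed_segment_horizontal closed_segment_vertical
          closed_segment_commute[of "facet_point (2 / real i - 1) 1 0"]
          closed_segment_commute[of "facet_point (-1) 1 0" "facet_point (-1) (-1) 0"])
  qed
qed

section \<open>A book embedding of the complete graph\<close>

text \<open>
  Injective on unordered pairs and with values between 0 and 1, so that each chord has a
  page of its own.
\<close>

definition height :: "nat \<Rightarrow> nat \<Rightarrow> real" where
  "height i j = 1 / (1 + real (prod_encode (min i j, max i j)))"

lemma height_commute: "height i j = height j i"
  by (simp add: height_def min.commute max.commute)

lemma height_bounds: "\<bar>height i j\<bar> \<le> 1"
  by (simp add: height_def)

lemma height_eq_iff: "height i j = height k l \<longleftrightarrow> {i, j} = {k, l}"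
proof
  assume "height i j = height k l"
  then have "prod_encode (min i j, max i j) = prod_encode (min k l, max k l)"
    by (simp add: height_def)
  then show "{i, j} = {k, l}"
    by (auto simp: prod_encode_eq min_def max_def split: if_splits)
next
  assume "{i, j} = {k, l}"
  then show "height i j = height k l"
    by (auto simp: doubleton_eq_iff height_commute)
qed

definition consecutive :: "nat \<Rightarrow> nat \<Rightarrow> nat \<Rightarrow> bool" where
  "consecutive n i j \<longleftrightarrow> j = Suc i mod n \<or> i = Suc j mod n"

text \<open>
  The point in which the strand from \<open>node i\<close> to \<open>node j\<close> turns. It depends only on the
  unordered pair, which makes the two orientations of an edge reverse to each other.
\<close>

definition elbow :: "nat \<Rightarrow> nat \<Rightarrow> nat \<Rightarrow> real ^ 4" where
  "elbow n i j = (if j = Suc i mod n then bend n i else if i = Suc j mod n then bend n j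
     else apex (height i j))"

definition strand :: "nat \<Rightarrow> nat \<Rightarrow> nat \<Rightarrow> real \<Rightarrow> real ^ 4" where
  "strand n i j = linepath (node i) (elbow n i j) +++ linepath (elbow n i j) (node j)"

text \<open>
  This fails for \<open>n = 2\<close>, where the two sides between the two nodes would compete for the
  same pair.
\<close>

lemma Suc_mod_asym:
  assumes "3 \<le> n" "i < n"
  shows "Suc (Suc i mod n) mod n \<noteq> i"
  using assms by (auto simp: mod_Suc split: if_splits)

lemma elbow_commute:
  assumes "3 \<le> n" "i < n" "j < n"
  shows "elbow n i j = elbow n j i"
  using assms Suc_mod_asym[of n i] Suc_mod_asym[of n j] by (auto simp: elbow_def height_commute)

lemma strand_reverse:
  assumes "3 \<le> n" "i < n" "j < n"
  shows "strand n j i = reversepath (strand n i j)"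
  by (simp add: strand_def reversepath_joinpaths elbow_commute[OF assms])

lemma path_image_strand_commute:
  assumes "3 \<le> n" "i < n" "j < n"
  shows "path_image (strand n j i) = path_image (strand n i j)"
  by (simp add: strand_reverse[OF assms])

lemma path_image_strand_side: "path_image (strand n i (Suc i mod n)) = side n i"
  by (simp add: strand_def path_image_two_segments elbow_def side_def)

lemma path_image_strand_consecutive:
  assumes "3 \<le> n" "i < n" "j < n" "consecutive n i j"
  obtains k where "k < n" "{i, j} = {k, Suc k mod n}" "path_image (strand n i j) = side n k"
proof (cases "j = Suc i mod n")
  case True
  then show ?thesis using that[of i] assms path_image_strand_side by auto
next
  case False
  then have "i = Suc j mod n" using assms by (simp add: consecutive_def)
  then show ?thesis
    using that[of j] assms path_image_strand_side[of n j] path_image_strand_commute[of n i j] by auto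
qed

lemma path_image_strand_chord:
  assumes "\<not> consecutive n i j"
  shows "path_image (strand n i j) =
     closed_segment (node i) (apex (height i j)) \<union> closed_segment (apex (height i j)) (node j)"
  using assms by (simp add: strand_def path_image_two_segments elbow_def consecutive_def)

lemma chord_subset_page:
  assumes "\<not> consecutive n i j"
  shows "path_image (strand n i j) \<subseteq> page (height i j)"
  using spoke_subset_page[OF node_in_square]
  by (simp add: path_image_strand_chord[OF assms] closed_segment_commute[of "apex _"])

text \<open>
  Since a chord meets the cycle only in its ends, removing the cycle from the
  graph leaves the open chord.
\<close>

lemma chord_Int_square:
  assumes "\<not> consecutive n i j"
  shows "path_image (strand n i j) \<inter> square = {node i, node j}"
  using spoke_Int_square[OF node_in_square]
  by (simp add: path_image_strand_chord[OF assms] closed_segment_commute[of "apex _"] Int_Un_distrib2) blast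

lemma arc_strand:
  assumes "3 \<le> n" "i < n" "j < n" "i \<noteq> j"
  shows "arc (strand n i j)"
proof -
  have next_arc: "arc (strand n k (Suc k mod n))" if "k < n" for k
    using arc_side[OF assms(1) that] by (simp add: strand_def elbow_def)
  consider "j = Suc i mod n" | "i = Suc j mod n" | "\<not> consecutive n i j"
    by (auto simp: consecutive_def)
  then show ?thesis
  proof cases
    case 1
    then show ?thesis using next_arc assms by simp
  next
    case 2
    then have "arc (strand n j i)" using next_arc assms by simp
    then show ?thesis using strand_reverse[of n j i] assms arc_reversepath by metis
  next
    case 3
    then have "elbow n i j = apex (height i j)" by (simp add: elbow_def consecutive_def)
    moreover have "node k \<noteq> apex h" for k h
      using node_in_square apex_notin_square by metis
    ultimately show ?thesis
      unfolding strand_def using spokes_Int[OF node_in_square node_in_square] assms(4)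
      by (intro arc_two_segments) (metis node_eq_iff)+
  qed
qed

lemma path_image_strand_subset_S3:
  assumes "3 \<le> n" "i < n" "j < n"
  shows "path_image (strand n i j) \<subseteq> S3"
proof (cases "consecutive n i j")
  case True
  then obtain k where "k < n" "path_image (strand n i j) = side n k"
    using path_image_strand_consecutive assms by metis
  then show ?thesis
    using side_subset_square[OF assms(1)] square_subset_page[of 0] page_subset_S3[of 0] by force
next
  case False
  then show ?thesis
    using chord_subset_page page_subset_S3[OF height_bounds] by blast
qed

text \<open>
  For sides this follows from the intersection of different sides: a node \<open>v\<close> also lies on the
  side that starts at \<open>v\<close>.
\<close>

lemma node_in_strand:
  assumes n: "3 \<le> n" and "i < n" "j < n" "v < n" and v: "node v \<in> path_image (strand n i j)"
  shows "v \<in> {i, j}"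
proof (cases "consecutive n i j")
  case True
  then obtain k where k: "k < n" "{i, j} = {k, Suc k mod n}" "path_image (strand n i j) = side n k"
    using path_image_strand_consecutive assms by metis
  have "node v \<in> side n v"
    by (simp add: side_def)
  then have "node v \<in> side n v \<inter> side n k"
    using v k(3) by simp
  then have "v \<noteq> k \<Longrightarrow> node v \<in> node ` ({v, Suc v mod n} \<inter> {k, Suc k mod n})"
    using sides_Int[OF n \<open>v < n\<close> \<open>k < n\<close>] by (meson subsetD)
  then have "v \<in> {k, Suc k mod n}"
    by fastforce
  then show ?thesis
    using k(2) by simp
next
  case False
  have "node v \<in> path_image (strand n i j) \<inter> square"
    using v node_in_square by simp
  then show ?thesis
    unfolding chord_Int_square[OF False] by auto
qed

text \<open>
  Two sides meet at most in a common endpoint; a chord meets a side, or a chord on another page, only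
  on the square, hence in an endpoint of the chord.
\<close>

lemma strands_Int:
  assumes n: "3 \<le> n" and ij: "i < n" "j < n" and kl: "k < n" "l < n" and ne: "{i, j} \<noteq> {k, l}"
  shows "path_image (strand n i j) \<inter> path_image (strand n k l) \<subseteq> node ` ({i, j} \<inter> {k, l})"
proof -
  have chord: "path_image (strand n i j) \<inter> path_image (strand n k l) \<subseteq> node ` ({i, j} \<inter> {k, l})"
    if "\<not> consecutive n i j" "path_image (strand n i j) \<inter> path_image (strand n k l) \<subseteq> square"
      "i < n" "j < n" "k < n" "l < n" for i j k l
  proof
    fix q assume q: "q \<in> path_image (strand n i j) \<inter> path_image (strand n k l)"
    then have "q \<in> {node i, node j}"
      using that chord_Int_square[OF that(1)] by blast
    then obtain v where v: "v \<in> {i, j}" "q = node v" by blast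
    then have "v \<in> {k, l}"
      using node_in_strand[OF n \<open>k < n\<close> \<open>l < n\<close>, of v] q that by auto
    then show "q \<in> node ` ({i, j} \<inter> {k, l})" using v by blast
  qed
  have in_square: "path_image (strand n i j) \<subseteq> square"
    if "consecutive n i j" "i < n" "j < n" for i j
    using path_image_strand_consecutive[OF n that(2,3,1)] side_subset_square[OF n] by metis
  consider "consecutive n i j" "consecutive n k l" | "\<not> consecutive n i j" "consecutive n k l"
    | "\<not> consecutive n k l" "consecutive n i j" | "\<not> consecutive n i j" "\<not> consecutive n k l"
    by blast
  then show ?thesis
  proof cases
    case 1
    obtain a where a: "a < n" "{i, j} = {a, Suc a mod n}" "path_image (strand n i j) = side n a"
      using path_image_strand_consecutive[OF n ij 1(1)] .
    obtain b where b: "b < n" "{k, l} = {b, Suc b mod n}" "path_image (strand n k l) = side n b"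
      using path_image_strand_consecutive[OF n kl 1(2)] .
    have "a \<noteq> b" using a b ne by auto
    then show ?thesis
      using sides_Int[OF n a(1) b(1)] unfolding a b by blast
  next
    case 2
    then show ?thesis using chord[of i j k l] in_square[of k l] ij kl by blast
  next
    case 3
    then show ?thesis using chord[of k l i j] in_square[of i j] ij kl by blast
  next
    case 4
    then have "path_image (strand n i j) \<inter> path_image (strand n k l) \<subseteq> square"
      using chord_subset_page pages_disjoint[of "height i j" "height k l"] ne by (fastforce simp: height_eq_iff)
    then show ?thesis using chord[of i j k l] 4 ij kl by blast
  qed
qed

section \<open>Embedding a Hamiltonian graph\<close>

text \<open>
  The vertices are numbered in the order in which the cycle visits them. Since the cycle is closed,
  the lists of tails and of heads of its arcs are rotations of each other, so the tails are distinct
  as the heads are.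
\<close>

lemma hamiltonian_index:
  fixes G :: "('a, 'b) pre_digraph"
  assumes p: "ugraph_cycle G p" "tail G ` set p = verts G"
  obtains idx where "bij_betw idx (verts G) {..<length p}"
    and "\<And>i. i < length p \<Longrightarrow> idx (tail G (p ! i)) = i \<and> idx (head G (p ! i)) = Suc i mod length p"
proof -
  obtain u where walk: "pre_digraph.awalk G u p u" and dist: "distinct (tl (pre_digraph.awalk_verts G u p))"
    and "p \<noteq> []"
    using p(1) by (auto simp: ugraph_cycle_def pre_digraph.cycle_def)
  let ?n = "length p"
  have cas: "pre_digraph.cas G u p u"
    using walk by (simp add: pre_digraph.awalk_def)
  have closed: "map (tail G) p @ [u] = u # map (head G) p"
  proof -
    have "map (tail G) q @ [w] = v # map (head G) q" if "pre_digraph.cas G v q w" for v q w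
      using that by (induction q arbitrary: v) (auto simp: pre_digraph.cas.simps)
    then show ?thesis using cas .
  qed
  have heads: "tl (pre_digraph.awalk_verts G u p) = map (head G) p"
    using \<open>p \<noteq> []\<close> cas by (simp add: pre_digraph.awalk_verts_conv'[OF cas])
  have "mset (map (tail G) p) = mset (map (head G) p)"
    using arg_cong[OF closed, of mset] by simp
  then have dist_tails: "distinct (map (tail G) p)"
    using dist heads mset_eq_imp_distinct_iff by metis
  have tail_next: "head G (p ! i) = tail G (p ! (Suc i mod ?n))" if "i < ?n" for i
  proof -
    have "head G (p ! i) = (map (tail G) p @ [u]) ! Suc i"
      using that by (simp add: closed)
    moreover have "u = tail G (p ! 0)"
      using arg_cong[OF closed, of "\<lambda>xs. xs ! 0"] \<open>p \<noteq> []\<close> by (simp add: nth_append)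
    ultimately show ?thesis
      using that by (cases "Suc i = ?n") (auto simp: nth_append)
  qed
  have bij: "bij_betw (\<lambda>i. tail G (p ! i)) {..<?n} (verts G)"
    unfolding bij_betw_def
  proof
    show "inj_on (\<lambda>i. tail G (p ! i)) {..<?n}"
      using dist_tails by (auto simp: inj_on_def distinct_conv_nth)
    show "(\<lambda>i. tail G (p ! i)) ` {..<?n} = verts G"
      using p(2) by (auto simp: set_conv_nth image_def)
  qed
  let ?idx = "the_inv_into {..<?n} (\<lambda>i. tail G (p ! i))"
  have left_inv: "?idx (tail G (p ! i)) = i" if "i < ?n" for i
    using the_inv_into_f_f[OF bij_betw_imp_inj_on[OF bij], of i] that by simp
  have "?n > 0" using \<open>p \<noteq> []\<close> by simp
  show ?thesis
  proof (rule that[of ?idx])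
    show "bij_betw ?idx (verts G) {..<?n}"
      using bij_betw_the_inv_into[OF bij] .
    show "?idx (tail G (p ! i)) = i \<and> ?idx (head G (p ! i)) = Suc i mod ?n" if "i < ?n" for i
      using that left_inv tail_next[OF that] \<open>?n > 0\<close> by simp
  qed
qed

text \<open>
  A graph with a numbering of its vertices is a subgraph of a complete graph, and it inherits the
  embedding.
\<close>

lemma graph_embedding_strands:
  fixes G :: "('a, 'b) pre_digraph"
  assumes "graph G" "3 \<le> n" and inj: "inj_on idx (verts G)" and less: "idx ` verts G \<subseteq> {..<n}"
  shows "graph_embedding G (node \<circ> idx) (\<lambda>e. strand n (idx (tail G e)) (idx (head G e)))"
proof -
  interpret graph G by fact
  have ends: "idx (tail G e) < n" "idx (head G e) < n" "idx (tail G e) \<noteq> idx (head G e)"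
    "{tail G e, head G e} \<subseteq> verts G" if "e \<in> arcs G" for e
    using that less no_loops[OF that] inj wellformed by (auto simp: inj_on_def image_subset_iff)
  let ?\<gamma> = "\<lambda>e. strand n (idx (tail G e)) (idx (head G e))"
  have "node ` idx ` verts G \<subseteq> S3"
    using node_in_square square_subset_page[of 0] page_subset_S3[of 0] by force
  moreover have "inj_on (node \<circ> idx) (verts G)"
    using inj by (auto simp: inj_on_def)
  moreover have "Path_Connected.arc (?\<gamma> e) \<and> pl_on {0..1} (?\<gamma> e) \<and> path_image (?\<gamma> e) \<subseteq> S3 \<and>
      pathstart (?\<gamma> e) = node (idx (tail G e)) \<and> pathfinish (?\<gamma> e) = node (idx (head G e))"
    if "e \<in> arcs G" for e
    using ends[OF that] arc_strand path_image_strand_subset_S3 assms(2)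
    by (simp add: pl_on_two_segments strand_def)
  moreover have "?\<gamma> e' = reversepath (?\<gamma> e)"
    if "e \<in> arcs G" "tail G e' = head G e" "head G e' = tail G e" for e e'
    unfolding that(2,3) using ends[OF that(1)] by (intro strand_reverse assms(2))
  moreover have "v \<in> {tail G e, head G e}"
    if "e \<in> arcs G" "v \<in> verts G" "node (idx v) \<in> path_image (?\<gamma> e)" for e v
  proof -
    have "idx v \<in> idx ` {tail G e, head G e}"
      using node_in_strand[OF assms(2) ends(1,2)[OF that(1)] _ that(3)] that(2) less by auto
    then show ?thesis
      using inj_on_image_mem_iff[OF inj that(2) ends(4)[OF that(1)]] by blast
  qed
  moreover have "path_image (?\<gamma> e) \<inter> path_image (?\<gamma> e')
      \<subseteq> (node \<circ> idx) ` ({tail G e, head G e} \<inter> {tail G e', head G e'})"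
    if e: "e \<in> arcs G" and e': "e' \<in> arcs G"
      and ne: "{tail G e, head G e} \<noteq> {tail G e', head G e'}" for e e'
  proof -
    have "idx ` {tail G e, head G e} \<noteq> idx ` {tail G e', head G e'}"
      using ne inj_on_image_eq_iff[OF inj ends(4)[OF e] ends(4)[OF e']] by blast
    then show ?thesis
      using strands_Int[OF assms(2) ends(1,2)[OF e] ends(1,2)[OF e']]
        inj_on_image_Int[OF inj ends(4)[OF e] ends(4)[OF e']]
      by (simp only: image_insert image_empty image_comp[symmetric] simp_thms)
  qed
  ultimately show ?thesis
    unfolding graph_embedding_def by (auto simp: image_comp)
qed

text \<open>
  The set \<open>E\<close> may contain a chord in both orientations, and these yield the same
  fragment; so the open chords are pairwise disjoint as a set of sets, not as a family indexed by \<open>E\<close>.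
\<close>

lemma fragments_chords:
  assumes chords: "finite E" "\<And>i j. (i, j) \<in> E \<Longrightarrow> i < n \<and> j < n \<and> i \<noteq> j \<and> \<not> consecutive n i j"
    and n: "3 \<le> n"
  shows "fragments (square \<union> (\<Union>(i, j)\<in>E. path_image (strand n i j))) square =
     (\<lambda>(i, j). closure (path_image (strand n i j) - square)) ` E"
proof -
  let ?X = "\<lambda>(i, j). path_image (strand n i j) - square"
  have closedin: "closedin (top_of_set (\<Union>(?X ` E))) (?X (i, j))" if "(i, j) \<in> E" for i j
  proof -
    have "closed (path_image (strand n i j))"
      using arc_strand[OF n] chords(2)[OF that] closed_arc_image by blast
    moreover have "?X (i, j) = \<Union>(?X ` E) \<inter> path_image (strand n i j)"
      using that by auto
    ultimately show ?thesis
      unfolding closedin_closed by blast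
  qed
  have conn: "Topological_Spaces.connected (?X (i, j)) \<and> ?X (i, j) \<noteq> {}" if "(i, j) \<in> E" for i j
  proof -
    have "simple_path (strand n i j)"
      using arc_strand[OF n] chords(2)[OF that] arc_imp_simple_path by blast
    moreover have "?X (i, j) = path_image (strand n i j) - {pathstart (strand n i j), pathfinish (strand n i j)}"
      using chord_Int_square[of n i j] chords(2)[OF that] by (auto simp: strand_def)
    ultimately show ?thesis
      using connected_simple_path_endless nonempty_simple_path_endless by metis
  qed
  have "disjnt (?X (i, j)) (?X (k, l))" if "(i, j) \<in> E" "(k, l) \<in> E" "?X (i, j) \<noteq> ?X (k, l)" for i j k l
  proof -
    have "height i j \<noteq> height k l"
    proof
      assume "height i j = height k l"
      then have "{i, j} = {k, l}" by (simp add: height_eq_iff)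
      then have "path_image (strand n i j) = path_image (strand n k l)"
        using path_image_strand_commute[OF n] chords(2) that(1) by (auto simp: doubleton_eq_iff)
      then show False using that(3) by simp
    qed
    then show ?thesis
      using pages_disjoint[of "height i j" "height k l"] chord_subset_page[of n i j] chord_subset_page[of n k l]
        chords(2) that(1,2) by (fastforce simp: disjnt_def)
  qed
  then have "pairwise disjnt (?X ` E)"
    unfolding pairwise_image by (intro pairwiseI) force
  then have "components (\<Union>(?X ` E)) = ?X ` E"
    using chords(1) closedin conn by (intro components_Union_disjoint) auto
  moreover have "square \<union> (\<Union>(i, j)\<in>E. path_image (strand n i j)) - square = \<Union>(?X ` E)"
    by auto
  ultimately show ?thesis
    by (simp add: fragments_def image_image case_prod_unfold)
qed

text \<open>
  Each fragment is a chord, and it lies on the page at the height of this chord. The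
  rest of the graph meets this page only in the square, because the other chords lie on other pages.
\<close>

lemma spine_square:
  assumes chords: "finite E" "\<And>i j. (i, j) \<in> E \<Longrightarrow> i < n \<and> j < n \<and> i \<noteq> j \<and> \<not> consecutive n i j"
    and n: "3 \<le> n"
  shows "spine (square \<union> (\<Union>(i, j)\<in>E. path_image (strand n i j))) square"
proof -
  let ?G = "square \<union> (\<Union>(i, j)\<in>E. path_image (strand n i j))"
  let ?f = "\<lambda>(i, j). closure (path_image (strand n i j) - square)"
  let ?F = "fragments ?G square"
  \<comment> \<open>Either orientation of the chord may be picked here: both have the same height.\<close>
  define D where "D f = (case inv_into E ?f f of (i, j) \<Rightarrow> page (height i j))" for f
  have F: "?F = ?f ` E"
    using fragments_chords[OF assms] .
  have D: "\<exists>i j. (i, j) \<in> E \<and> f = ?f (i, j) \<and> D f = page (height i j)" if "f \<in> ?F" for f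
  proof -
    obtain i j where "inv_into E ?f f = (i, j)" by fastforce
    moreover from this have "(i, j) \<in> E" "f = ?f (i, j)"
      using that inv_into_into[of f ?f E] f_inv_into_f[of f ?f E] unfolding F by auto
    ultimately show ?thesis by (auto simp: D_def)
  qed
  have f_page: "?f (i, j) \<subseteq> page (height i j)" if "(i, j) \<in> E" for i j
  proof -
    have "closed (path_image (strand n i j))"
      using arc_strand[OF n] chords(2)[OF that] closed_arc_image by blast
    then have "?f (i, j) \<subseteq> path_image (strand n i j)"
      using closure_minimal[of "path_image (strand n i j) - square"] by auto
    then show ?thesis
      using chord_subset_page chords(2)[OF that] by blast
  qed
  have same: "path_image (strand n i j) = path_image (strand n k l)"
    if "(i, j) \<in> E" "height i j = height k l" for i j k l
    using that(2) path_image_strand_commute[OF n] chords(2)[OF that(1)]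
    by (auto simp: height_eq_iff doubleton_eq_iff)
  have "disk_with_boundary (D f) square \<and> f \<subseteq> D f \<and> (D f - square) \<inter> (?G - f) = {}"
    if f: "f \<in> ?F" for f
  proof -
    obtain i j where ij: "(i, j) \<in> E" "f = ?f (i, j)" "D f = page (height i j)"
      using D[OF f] by blast
    have "q \<in> f" if q: "q \<in> page (height i j) - square" "q \<in> ?G" for q
    proof -
      obtain k l where kl: "(k, l) \<in> E" "q \<in> path_image (strand n k l)"
        using q by auto
      then have "q \<in> page (height k l)"
        using chord_subset_page chords(2) by blast
      then have "height i j = height k l"
        using q(1) pages_disjoint by blast
      then have "q \<in> path_image (strand n i j) - square"
        using same[OF ij(1)] kl q by blast
      then show ?thesis
        using closure_subset ij(2) by fastforce
    qed
    then show ?thesis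
      using disk_page[OF height_bounds] f_page ij by auto
  qed
  moreover have "(D f - square) \<inter> (D g - square) = {}" if fg: "f \<in> ?F" "g \<in> ?F" "f \<noteq> g" for f g
  proof -
    obtain i j where ij: "(i, j) \<in> E" "f = ?f (i, j)" "D f = page (height i j)"
      using D[OF fg(1)] by blast
    obtain k l where kl: "(k, l) \<in> E" "g = ?f (k, l)" "D g = page (height k l)"
      using D[OF fg(2)] by blast
    have "height i j \<noteq> height k l"
    proof
      assume "height i j = height k l"
      then have "f = g"
        unfolding ij(2) kl(2) using same[OF ij(1)] by simp
      then show False
        using fg(3) by simp
    qed
    then show ?thesis
      using pages_disjoint ij kl by blast
  qed
  ultimately show ?thesis
    unfolding spine_def by (intro conjI exI[of _ D] unknotted_square ballI impI) simp_all
qed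

theorem corollary1:
  fixes G :: "('a, 'b) pre_digraph"
  assumes "graph G" and "Digraph_Component.connected G" and "hamiltonian G"
  shows "\<exists>\<phi> \<gamma>. leveled_embedding G \<phi> \<gamma>"
proof -
  interpret graph G by fact
  obtain p where p: "ugraph_cycle G p" "tail G ` set p = verts G"
    using assms(3) by (auto simp: hamiltonian_def)
  define n where "n = length p"
  have n: "3 \<le> n" and p_arcs: "set p \<subseteq> arcs G"
    using p(1) by (auto simp: ugraph_cycle_def cycle_def awalk_def n_def)
  obtain idx where bij: "bij_betw idx (verts G) {..<n}"
    and idx: "\<And>i. i < n \<Longrightarrow> idx (tail G (p ! i)) = i \<and> idx (head G (p ! i)) = Suc i mod n"
    using hamiltonian_index[OF p] unfolding n_def by blast
  have inj: "inj_on idx (verts G)" and img: "idx ` verts G = {..<n}"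
    using bij by (auto simp: bij_betw_def)
  define \<gamma> where "\<gamma> = (\<lambda>e. strand n (idx (tail G e)) (idx (head G e)))"
  \<comment> \<open>The arcs that do not join consecutive nodes of the cycle, in terms of the numbering.\<close>
  define E where "E = {(i, j) \<in> (\<lambda>e. (idx (tail G e), idx (head G e))) ` arcs G. \<not> consecutive n i j}"
  have E: "finite E" "\<And>i j. (i, j) \<in> E \<Longrightarrow> i < n \<and> j < n \<and> i \<noteq> j \<and> \<not> consecutive n i j"
  proof -
    show "finite E"
      by (rule finite_subset[of _ "(\<lambda>e. (idx (tail G e), idx (head G e))) ` arcs G"]) (auto simp: E_def)
    fix i j assume "(i, j) \<in> E"
    then obtain e where "e \<in> arcs G" "i = idx (tail G e)" "j = idx (head G e)" "\<not> consecutive n i j"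
      by (auto simp: E_def)
    then show "i < n \<and> j < n \<and> i \<noteq> j \<and> \<not> consecutive n i j"
      using img inj no_loops[of e] by (auto simp: inj_on_eq_iff)
  qed
  have cyc: "cycle_image \<gamma> p = square"
  proof -
    have "cycle_image \<gamma> p = (\<Union>i<n. path_image (\<gamma> (p ! i)))"
      by (auto simp: cycle_image_def n_def set_conv_nth)
    also have "\<dots> = (\<Union>i<n. side n i)"
      using idx by (simp add: \<gamma>_def path_image_strand_side)
    finally show ?thesis
      using Union_sides[OF n] by simp
  qed
  have "spatial_graph G (node \<circ> idx) \<gamma> = square \<union> (\<Union>(i, j)\<in>E. path_image (strand n i j))" (is "?L = ?R")
  proof
    have "path_image (\<gamma> e) \<subseteq> ?R" if e: "e \<in> arcs G" for e
    proof (cases "consecutive n (idx (tail G e)) (idx (head G e))")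
      case True
      then have "path_image (\<gamma> e) \<subseteq> square"
        using path_image_strand_consecutive[OF n _ _ True] side_subset_square[OF n] img e
        unfolding \<gamma>_def by (metis imageI lessThan_iff tail_in_verts head_in_verts)
      then show ?thesis by blast
    next
      case False
      then have "(idx (tail G e), idx (head G e)) \<in> E"
        using e by (auto simp: E_def)
      then show ?thesis unfolding \<gamma>_def by blast
    qed
    then show "?L \<subseteq> ?R"
      using node_in_square by (auto simp: spatial_graph_def)
    have "square \<subseteq> ?L"
      unfolding cyc[symmetric] using p_arcs by (auto simp: cycle_image_def spatial_graph_def)
    moreover have "path_image (strand n i j) \<subseteq> ?L" if "(i, j) \<in> E" for i j
      using that by (auto simp: E_def spatial_graph_def \<gamma>_def)
    ultimately show "?R \<subseteq> ?L"
      by blast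
  qed
  then have "spine (spatial_graph G (node \<circ> idx) \<gamma>) (cycle_image \<gamma> p)"
    using spine_square[OF E n] cyc by simp
  moreover have "graph_embedding G (node \<circ> idx) \<gamma>"
    unfolding \<gamma>_def using graph_embedding_strands[OF assms(1) n inj] img by simp
  ultimately show ?thesis
    unfolding leveled_embedding_def using p(1) by blast
qed

end
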